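(* Let $f(x)=\sum_{n\ge 1} a_n x^n$, where $a_n$ is the number of permutations of length $n$ that avoid both $4312$ and $3142$. Then $f$ satisfies \[ (x^3-2x^2+x)f^4+(4x^3-9x^2+6x-1)f^3+(6x^3-12x^2+7x-1)f^2+(4x^3-5x^2+x)f+x^3=0. \]
   Context: A permutation $\pi$ avoids $\sigma$ if no subsequence of $\pi$ is order-isomorphic to $\sigma$. The generating function counts nonempty permutations only (no constant term). *)

theory Defs
  imports "HOL-Combinatorics.Multiset_Permutations" "HOL-Library.Sublist"
    "HOL-Computational_Algebra.Formal_Power_Series"
begin

definition order_iso :: "nat list \<Rightarrow> nat list \<Rightarrow> bool" where
  "order_iso xs ys \<longleftrightarrow> length xs = length ys \<and>
     (\<forall>i<length xs. \<forall>j<length xs. (xs ! i < xs ! j) = (ys ! i < ys ! j))"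

definition contains_pattern :: "nat list \<Rightarrow> nat list \<Rightarrow> bool" where
  "contains_pattern p s \<longleftrightarrow> (\<exists>ys. subseq ys p \<and> order_iso ys s)"

definition avoids :: "nat list \<Rightarrow> nat list \<Rightarrow> bool" where
  "avoids p s \<longleftrightarrow> \<not> contains_pattern p s"

definition av_count :: "nat \<Rightarrow> nat" where
  "av_count n = card {p \<in> permutations_of_set {1..n}.
      avoids p [4,3,1,2] \<and> avoids p [3,1,4,2]}"

definition av_gf :: "int fps" where
  "av_gf = Abs_fps (\<lambda>n. if n = 0 then 0 else int (av_count n))"

end

theory Submission
  imports Defs
begin

text \<open>
  Decompose a nonempty avoider by its last entry \<open>v\<close>, writing it as \<open>\<sigma> v\<close>. The patterns 4312 and 3142
  forbid that \<open>\<sigma>\<close> has an inversion \<open>b a\<close> with \<open>a < v < b\<close> and an entry larger than \<open>b\<close> that lies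
  outside the stretch between \<open>b\<close> and \<open>a\<close>. Hence either all entries below \<open>v\<close> precede all
  entries above \<open>v\<close>, or \<open>\<sigma> = B\<^sub>1 I B\<^sub>2 T\<close>, where \<open>B\<^sub>1, B\<^sub>2\<close> are the entries below \<open>v\<close>, \<open>B\<^sub>2\<close> is
  nonempty, \<open>I\<close> is a nonempty increasing run of the largest values, and \<open>T\<close>
  holds the other entries above \<open>v\<close>. In the second case \<open>\<sigma>\<close> is
  an avoider iff \<open>T\<close> avoids 312 and \<open>B\<^sub>1 m B\<^sub>2\<close> is an avoider, where a single new maximum \<open>m\<close>
  replaces \<open>I\<close>. With \<open>F = 1 + f\<close> and the Catalan series \<open>C = 1 + x C\<^sup>2\<close> this gives
  \<open>F = 1 + x F\<^sup>2 + x (x / (1 - x)) G C\<close>, where \<open>x G = F - 1 - x F\<close> because \<open>G\<close> counts the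
  avoiders whose maximum is not last. Eliminating \<open>C\<close> yields \<open>x\<close> times the stated equation.
\<close>

section \<open>Avoidance expressed through entries of sublists\<close>

text \<open>Patterns are encoded by inequalities between the entries of short sublists, so that
  arguments about concatenations become finite case splits and linear arithmetic.\<close>

definition avoids_312 :: "nat list \<Rightarrow> bool" where
  "avoids_312 p \<longleftrightarrow> (\<forall>a b c. subseq [a, b, c] p \<longrightarrow> \<not> (b < c \<and> c < a))"

definition avoids_4312_3142 :: "nat list \<Rightarrow> bool" where
  "avoids_4312_3142 p \<longleftrightarrow> (\<forall>a b c d. subseq [a, b, c, d] p \<longrightarrow>
     \<not> (c < d \<and> d < b \<and> b < a) \<and> \<not> (b < d \<and> d < a \<and> a < c))"

text \<open>Rewriting with these rules unrolls the cut point of an explicit list, which turns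
  \<open>subseq_append_iff\<close> into the finite disjunctions of
  \<open>subseq_append_cases\<close>.\<close>

lemma ex_split_Cons:
  "(\<exists>us vs. [] = us @ vs \<and> P us vs) \<longleftrightarrow> P [] []"
  "(\<exists>us vs. x # l = us @ vs \<and> P us vs) \<longleftrightarrow> P [] (x # l) \<or> (\<exists>us vs. l = us @ vs \<and> P (x # us) vs)"
  by (auto simp: Cons_eq_append_conv)

lemma subseq_append_cases:
  "subseq [a, b] (xs @ ys) \<longleftrightarrow> subseq [a, b] xs \<or> a \<in> set xs \<and> b \<in> set ys \<or> subseq [a, b] ys"
  "subseq [a, b, c] (xs @ ys) \<longleftrightarrow> subseq [a, b, c] xs \<or> subseq [a, b] xs \<and> c \<in> set ys
     \<or> a \<in> set xs \<and> subseq [b, c] ys \<or> subseq [a, b, c] ys"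
  "subseq [a, b, c, d] (xs @ ys) \<longleftrightarrow> subseq [a, b, c, d] xs \<or> subseq [a, b, c] xs \<and> d \<in> set ys
     \<or> subseq [a, b] xs \<and> subseq [c, d] ys \<or> a \<in> set xs \<and> subseq [b, c, d] ys
     \<or> subseq [a, b, c, d] ys"
  unfolding subseq_append_iff ex_split_Cons subseq_singleton_left list_emb_Nil by blast+

lemma set_subset_of_subseq: "subseq xs ys \<Longrightarrow> set xs \<subseteq> set ys"
  by (auto elim: list_emb_set)

lemma subseq_set_mem:
  "subseq [a, b] xs \<Longrightarrow> a \<in> set xs \<and> b \<in> set xs"
  "subseq [a, b, c] xs \<Longrightarrow> a \<in> set xs \<and> b \<in> set xs \<and> c \<in> set xs"
  "subseq [a, b, c, d] xs \<Longrightarrow> a \<in> set xs \<and> b \<in> set xs \<and> c \<in> set xs \<and> d \<in> set xs"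
  by (auto dest!: set_subset_of_subseq)

lemma avoids_4312_3142_iff:
  "avoids_4312_3142 p \<longleftrightarrow> avoids p [4, 3, 1, 2] \<and> avoids p [3, 1, 4, 2]"
proof -
  have len4: "length ys = Suc (Suc (Suc (Suc 0))) \<longleftrightarrow> (\<exists>a b c d. ys = [a, b, c, d])" for ys :: "nat list"
    by (auto simp: length_Suc_conv)
  have "order_iso [a, b, c, d] [4, 3, 1, 2] \<longleftrightarrow> c < d \<and> d < b \<and> b < a"
    "order_iso [a, b, c, d] [3, 1, 4, 2] \<longleftrightarrow> b < d \<and> d < a \<and> a < c" for a b c d
    by (simp_all add: order_iso_def All_less_Suc) linarith+
  then have iso1: "order_iso ys [4, 3, 1, 2] \<longleftrightarrow> (\<exists>a b c d. ys = [a, b, c, d] \<and> c < d \<and> d < b \<and> b < a)"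
    and iso2: "order_iso ys [3, 1, 4, 2] \<longleftrightarrow> (\<exists>a b c d. ys = [a, b, c, d] \<and> b < d \<and> d < a \<and> a < c)" for ys
    using len4[of ys] by (fastforce simp: order_iso_def[of ys])+
  show ?thesis
    unfolding avoids_def contains_pattern_def iso1 iso2 avoids_4312_3142_def by blast
qed

section \<open>Avoidance in concatenations of blocks\<close>

text \<open>In 312, as in 4312 and 3142, the first entry exceeds the last. An occurrence meeting
  both blocks would start in the lower block and end in the upper one, which is impossible.\<close>

lemma avoids_312_append:
  assumes "\<And>x y. x \<in> set xs \<Longrightarrow> y \<in> set ys \<Longrightarrow> x < y"
  shows "avoids_312 (xs @ ys) \<longleftrightarrow> avoids_312 xs \<and> avoids_312 ys"
proof -
  have "\<not> (b < c \<and> c < a)"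
    if "subseq [a, b] xs \<and> c \<in> set ys \<or> a \<in> set xs \<and> subseq [b, c] ys" for a b c
    using that assms[of a c] subseq_set_mem(1)[of a b xs] subseq_set_mem(1)[of b c ys] by linarith
  then show ?thesis
    unfolding avoids_312_def subseq_append_cases by blast
qed

lemma avoids_4312_3142_append:
  assumes "\<And>x y. x \<in> set xs \<Longrightarrow> y \<in> set ys \<Longrightarrow> x < y"
  shows "avoids_4312_3142 (xs @ ys) \<longleftrightarrow> avoids_4312_3142 xs \<and> avoids_4312_3142 ys"
proof -
  have "\<not> (c < d \<and> d < b \<and> b < a) \<and> \<not> (b < d \<and> d < a \<and> a < c)"
    if "subseq [a, b, c] xs \<and> d \<in> set ys \<or> subseq [a, b] xs \<and> subseq [c, d] ys
      \<or> a \<in> set xs \<and> subseq [b, c, d] ys" for a b c d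
    using that assms[of a d] subseq_set_mem(1)[of a b xs] subseq_set_mem(1)[of c d ys]
      subseq_set_mem(2)[of a b c xs] subseq_set_mem(2)[of b c d ys] by linarith
  then show ?thesis
    unfolding avoids_4312_3142_def subseq_append_cases by blast
qed

text \<open>Deleting the 4 from either 4312 or 3142 leaves a 312.\<close>

lemma avoids_312_imp: "avoids_312 p \<Longrightarrow> avoids_4312_3142 p"
  unfolding avoids_312_def avoids_4312_3142_def
proof (intro allI impI)
  fix a b c d
  assume H: "\<forall>a b c. subseq [a, b, c] p \<longrightarrow> \<not> (b < c \<and> c < a)" and sub: "subseq [a, b, c, d] p"
  have "subseq [b, c, d] [a, b, c, d]" "subseq [a, b, d] [a, b, c, d]" by auto
  with sub have "subseq [b, c, d] p" "subseq [a, b, d] p"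
    using subseq_order.trans by blast+
  with H show "\<not> (c < d \<and> d < b \<and> b < a) \<and> \<not> (b < d \<and> d < a \<and> a < c)"
    by blast
qed

lemma not_subseq_singleton: "\<not> subseq (a # b # l) [v]"
  by (auto dest: list_emb_length)

lemma avoids_312_snoc:
  "avoids_312 (xs @ [v]) \<longleftrightarrow> avoids_312 xs \<and> (\<forall>a b. subseq [a, b] xs \<longrightarrow> \<not> (b < v \<and> v < a))"
  unfolding avoids_312_def subseq_append_cases imp_disjL all_conj_distrib
  by (simp add: not_subseq_singleton)

text \<open>An occurrence that uses the final \<open>v\<close> must use it as the 2, the last entry
  of both patterns.\<close>

lemma avoids_4312_3142_snoc:
  "avoids_4312_3142 (xs @ [v]) \<longleftrightarrow> avoids_4312_3142 xs \<and>
    (\<forall>a b c. subseq [a, b, c] xs \<longrightarrow> \<not> (c < v \<and> v < b \<and> b < a) \<and> \<not> (b < v \<and> v < a \<and> a < c))"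
  unfolding avoids_4312_3142_def subseq_append_cases imp_disjL all_conj_distrib
  by (simp add: not_subseq_singleton)

lemma sorted_wrt_subseq:
  assumes "subseq xs ys" "sorted_wrt P ys"
  shows "sorted_wrt P xs"
  using assms by (induction rule: list_emb.induct) (auto dest: set_subset_of_subseq)

lemma sorted_wrt_subseqD:
  assumes "sorted_wrt (<) (I :: nat list)"
  shows "subseq [a, b] I \<Longrightarrow> a < b" "subseq [a, b, c] I \<Longrightarrow> a < b \<and> b < c"
    "subseq [a, b, c, d] I \<Longrightarrow> a < b \<and> b < c \<and> c < d"
  using assms by (auto dest: sorted_wrt_subseq)

lemma distinct_subseq:
  assumes "subseq xs ys" "distinct ys"
  shows "distinct xs"
  using assms by (induction rule: list_emb.induct) (auto dest: set_subset_of_subseq)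

lemma subseq_hd: "x \<in> set xs \<Longrightarrow> x \<noteq> hd xs \<Longrightarrow> subseq [hd xs, x] xs"
  by (cases xs) (auto simp: subseq_singleton_left)

lemma subseq_last: "x \<in> set xs \<Longrightarrow> x \<noteq> last xs \<Longrightarrow> subseq [x, last xs] xs"
  by (cases xs rule: rev_cases) (auto simp: subseq_append_cases)

lemma sorted_wrtI_subseq: "(\<And>a b. subseq [a, b] xs \<Longrightarrow> P a b) \<Longrightarrow> sorted_wrt P xs"
proof (induction xs)
  case (Cons x xs)
  have "P x y" if "y \<in> set xs" for y
    using that by (intro Cons.prems) (simp add: subseq_singleton_left)
  moreover have "sorted_wrt P xs"
    by (rule Cons.IH) (intro Cons.prems list_emb_Cons)
  ultimately show ?case by simp
qed simp

text \<open>Because \<open>I\<close> is increasing, contiguous and above everything else, an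
  occurrence can use at most one of its entries, and only as the 4. In 4312 the remaining 312 then
  lies in \<open>B2\<close>; in 3142 the 31 lies in \<open>B1\<close> and the 2 in
  \<open>B2\<close>.\<close>

lemma avoids_4312_3142_insert_block:
  assumes I: "I \<noteq> []" "sorted_wrt (<) I"
    and less: "\<And>x y. x \<in> set (B1 @ B2) \<Longrightarrow> y \<in> set I \<Longrightarrow> x < y"
  shows "avoids_4312_3142 (B1 @ I @ B2) \<longleftrightarrow>
    avoids_4312_3142 (B1 @ B2) \<and> avoids_312 B2 \<and>
    (\<forall>a b d. subseq [a, b] B1 \<longrightarrow> d \<in> set B2 \<longrightarrow> \<not> (b < d \<and> d < a))" (is "?L \<longleftrightarrow> ?R")
proof
  obtain m where m: "m \<in> set I" using I(1) by (cases I) auto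
  assume ?L
  then have L: "\<not> (c < d \<and> d < b \<and> b < a) \<and> \<not> (b < d \<and> d < a \<and> a < c)"
    if "subseq [a, b, c, d] (B1 @ I @ B2)" for a b c d
    using that unfolding avoids_4312_3142_def by blast
  have "subseq (B1 @ B2) (B1 @ I @ B2)"
    by (simp add: subseq_append' list_emb_append2)
  from L[OF subseq_order.trans[OF _ this]] have "avoids_4312_3142 (B1 @ B2)"
    unfolding avoids_4312_3142_def by blast
  moreover have "avoids_312 B2"
    unfolding avoids_312_def
  proof (intro allI impI notI)
    fix a b c assume *: "subseq [a, b, c] B2" "b < c \<and> c < a"
    then have "subseq [m, a, b, c] (B1 @ I @ B2)" "a < m"
      using m less[of a m] subseq_set_mem(2)[OF *(1)] unfolding subseq_append_cases by simp_all
    with L[of m a b c] * show False by blast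
  qed
  moreover have "\<not> (b < d \<and> d < a)" if *: "subseq [a, b] B1" "d \<in> set B2" for a b d
  proof -
    have "subseq [a, b, m, d] (B1 @ I @ B2)" "a < m"
      using m * less[of a m] subseq_set_mem(1)[OF *(1)]
      unfolding subseq_append_cases by simp_all
    with L[of a b m d] show ?thesis by blast
  qed
  ultimately show ?R by blast
next
  assume R: ?R
  show ?L
    unfolding avoids_4312_3142_def
  proof (intro allI impI)
    fix a b c d
    assume sub: "subseq [a, b, c, d] (B1 @ I @ B2)"
    have lt: "\<And>x y. x \<in> set B1 \<Longrightarrow> y \<in> set I \<Longrightarrow> x < y" "\<And>x y. x \<in> set B2 \<Longrightarrow> y \<in> set I \<Longrightarrow> x < y"
      using less by auto
    \<comment> \<open>The first three alternatives are those where \<open>I\<close> is missed or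
      supplies the 4. Every other distribution over the blocks yields \<open>a < b\<close> or
      \<open>a < d\<close>, whereas both patterns need \<open>b < a\<close> and
      \<open>d < a\<close>.\<close>
    from sub have "subseq [a, b, c, d] (B1 @ B2) \<or> a \<in> set I \<and> subseq [b, c, d] B2 \<or>
        subseq [a, b] B1 \<and> c \<in> set I \<and> d \<in> set B2 \<or> a < b \<or> a < d \<and> b < d"
      unfolding subseq_append_cases set_append Un_iff
      by (elim disjE conjE) (blast dest: subseq_set_mem sorted_wrt_subseqD[OF I(2)] intro: lt)+
    then show "\<not> (c < d \<and> d < b \<and> b < a) \<and> \<not> (b < d \<and> d < a \<and> a < c)"
    proof (elim disjE conjE)
      assume "subseq [a, b, c, d] (B1 @ B2)"
      with R show ?thesis unfolding avoids_4312_3142_def by blast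
    next
      assume *: "a \<in> set I" "subseq [b, c, d] B2"
      then have "c < a" "\<not> (c < d \<and> d < b)"
        using R lt subseq_set_mem(2)[OF *(2)] unfolding avoids_312_def by blast+
      then show ?thesis by linarith
    next
      assume *: "subseq [a, b] B1" "c \<in> set I" "d \<in> set B2"
      then have "b < c" "\<not> (b < d \<and> d < a)" using R lt subseq_set_mem(1)[OF *(1)] by blast+
      then show ?thesis by linarith
    qed auto
  qed
qed

text \<open>As \<open>T\<close> also lies below \<open>I\<close>, the previous criterion applies
  with \<open>B2 @ T\<close> in the role of \<open>B2\<close>. Each resulting condition then splits,
  because \<open>T\<close> lies above \<open>B1\<close> and \<open>B2\<close>.\<close>

lemma avoids_4312_3142_block_append:
  assumes I: "I \<noteq> []" "sorted_wrt (<) I"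
    and B: "\<And>x y. x \<in> set (B1 @ B2) \<Longrightarrow> y \<in> set (I @ T) \<Longrightarrow> x < y"
    and T: "\<And>x y. x \<in> set T \<Longrightarrow> y \<in> set I \<Longrightarrow> x < y"
  shows "avoids_4312_3142 (B1 @ I @ B2 @ T) \<longleftrightarrow> avoids_4312_3142 (B1 @ I @ B2) \<and> avoids_312 T"
proof -
  have 1: "avoids_4312_3142 (B1 @ I @ B2 @ T) \<longleftrightarrow> avoids_4312_3142 (B1 @ B2 @ T) \<and> avoids_312 (B2 @ T) \<and>
    (\<forall>a b d. subseq [a, b] B1 \<longrightarrow> d \<in> set (B2 @ T) \<longrightarrow> \<not> (b < d \<and> d < a))"
    using I B T by (intro avoids_4312_3142_insert_block) auto
  have 2: "avoids_4312_3142 (B1 @ B2 @ T) \<longleftrightarrow> avoids_4312_3142 (B1 @ B2) \<and> avoids_4312_3142 T"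
    using B avoids_4312_3142_append[of "B1 @ B2" T] by simp
  have 3: "avoids_312 (B2 @ T) \<longleftrightarrow> avoids_312 B2 \<and> avoids_312 T"
    using B by (intro avoids_312_append) auto
  have 4: "\<not> (b < d \<and> d < a)" if "subseq [a, b] B1" "d \<in> set T" for a b d
    using that B[of a d] subseq_set_mem(1)[of a b B1] by simp
  have 5: "avoids_4312_3142 (B1 @ I @ B2) \<longleftrightarrow>
    avoids_4312_3142 (B1 @ B2) \<and> avoids_312 B2 \<and>
    (\<forall>a b d. subseq [a, b] B1 \<longrightarrow> d \<in> set B2 \<longrightarrow> \<not> (b < d \<and> d < a))"
    using I B by (intro avoids_4312_3142_insert_block) auto
  show ?thesis
    unfolding 1 2 3 5 set_append Un_iff using 4 avoids_312_imp[of T] by blast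
qed

section \<open>Decomposition by the last entry\<close>

text \<open>With \<open>v\<close> as the 2 of a 312, no entry above \<open>v\<close> may be followed
  by one below \<open>v\<close>.\<close>

lemma avoids_312_snoc_iff:
  assumes "v \<notin> set xs"
  shows "avoids_312 (xs @ [v]) \<longleftrightarrow>
    (\<exists>B T. xs = B @ T \<and> (\<forall>x\<in>set B. x < v) \<and> (\<forall>x\<in>set T. v < x) \<and> avoids_312 B \<and> avoids_312 T)"
    (is "_ \<longleftrightarrow> ?R")
proof
  assume L: "avoids_312 (xs @ [v])"
  define B where "B = takeWhile (\<lambda>x. x < v) xs"
  define T where "T = dropWhile (\<lambda>x. x < v) xs"
  have xs: "xs = B @ T" and B: "\<forall>x\<in>set B. x < v"
    unfolding B_def T_def by (auto dest: set_takeWhileD)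
  have T: "\<forall>x\<in>set T. v < x"
  proof (cases T)
    case (Cons t T')
    then have "\<not> t < v" unfolding T_def by (metis hd_dropWhile list.distinct(1) list.sel(1))
    with assms xs Cons have "v < t" by auto
    moreover have "\<not> y < v" if "y \<in> set T'" for y
    proof -
      have "subseq [t, y] xs"
        using that Cons xs by (simp add: subseq_append_cases subseq_singleton_left)
      with L \<open>v < t\<close> show ?thesis unfolding avoids_312_snoc by blast
    qed
    ultimately show ?thesis using assms xs Cons by (auto simp: not_less le_less)
  qed simp
  have "avoids_312 xs" using L unfolding avoids_312_snoc by blast
  then show ?R using xs B T avoids_312_append[of B T] less_trans by blast
next
  assume ?R
  then obtain B T where *: "xs = B @ T" "\<forall>x\<in>set B. x < v" "\<forall>x\<in>set T. v < x" "avoids_312 B" "avoids_312 T"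
    by blast
  then have "avoids_312 xs" using avoids_312_append[of B T] less_trans by blast
  moreover have "\<not> (b < v \<and> v < a)" if "subseq [a, b] xs" for a b
    using that * unfolding *(1) subseq_append_cases by (auto dest!: subseq_set_mem)
  ultimately show "avoids_312 (xs @ [v])" unfolding avoids_312_snoc by blast
qed

text \<open>Call entries high or low according to their position relative to \<open>v\<close>. Once
  a high entry is followed by a low one, 4312 forbids descents among the high entries before that
  low one, and 3142 forbids later entries from exceeding that high one. This gives the shape of the
  second case.\<close>

lemma avoids_4312_3142_snoc_iff:
  assumes "v \<notin> set xs" "distinct xs"
  shows "avoids_4312_3142 (xs @ [v]) \<longleftrightarrow>
    (\<exists>B T. xs = B @ T \<and> (\<forall>x\<in>set B. x < v) \<and> (\<forall>x\<in>set T. v < x) \<and>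
      avoids_4312_3142 B \<and> avoids_4312_3142 T) \<or>
    (\<exists>B\<^sub>1 I B\<^sub>2 T. xs = B\<^sub>1 @ I @ B\<^sub>2 @ T \<and> I \<noteq> [] \<and> B\<^sub>2 \<noteq> [] \<and> sorted_wrt (<) I \<and>
      (\<forall>x\<in>set (B\<^sub>1 @ B\<^sub>2). x < v) \<and> (\<forall>x\<in>set (I @ T). v < x) \<and> (\<forall>x\<in>set T. \<forall>y\<in>set I. x < y) \<and>
      avoids_4312_3142 (B\<^sub>1 @ I @ B\<^sub>2) \<and> avoids_312 T)"
    (is "_ \<longleftrightarrow> ?R1 \<or> ?R2")
proof
  assume L: "avoids_4312_3142 (xs @ [v])"
  then have xs: "avoids_4312_3142 xs" unfolding avoids_4312_3142_snoc by blast
  \<comment> \<open>\<open>T\<close> is the longest high suffix, \<open>B\<^sub>1\<close> the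
    longest low prefix of the rest, and \<open>I\<close> the high run after it. That
    \<open>B\<^sub>2\<close> contains only low entries is not built in and is proved below. The
    first case is \<open>Y = []\<close>.\<close>
  define T where "T = rev (takeWhile (\<lambda>x. v < x) (rev xs))"
  define X where "X = rev (dropWhile (\<lambda>x. v < x) (rev xs))"
  define B\<^sub>1 where "B\<^sub>1 = takeWhile (\<lambda>x. x < v) X"
  define Y where "Y = dropWhile (\<lambda>x. x < v) X"
  define I where "I = takeWhile (\<lambda>x. v < x) Y"
  define B\<^sub>2 where "B\<^sub>2 = dropWhile (\<lambda>x. v < x) Y"
  have xsXT: "xs = X @ T" unfolding X_def T_def by (metis rev_append rev_rev_ident takeWhile_dropWhile_id)
  have X: "X = B\<^sub>1 @ Y" and Y: "Y = I @ B\<^sub>2" unfolding B\<^sub>1_def Y_def I_def B\<^sub>2_def by simp_all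
  have T: "v < x" if "x \<in> set T" for x using that unfolding T_def by (auto dest: set_takeWhileD)
  have B1: "x < v" if "x \<in> set B\<^sub>1" for x using that unfolding B\<^sub>1_def by (auto dest: set_takeWhileD)
  have I: "v < x" if "x \<in> set I" for x using that unfolding I_def by (auto dest: set_takeWhileD)
  show "?R1 \<or> ?R2"
  proof (cases "Y = []")
    case True
    then have "xs = B\<^sub>1 @ T" using xsXT X by simp
    moreover from this have "avoids_4312_3142 B\<^sub>1 \<and> avoids_4312_3142 T"
      using xs avoids_4312_3142_append[of B\<^sub>1 T] B1 T less_trans by blast
    ultimately show ?thesis using B1 T by blast
  next
    case False
    have lastX: "last X < v"
    proof -
      have ne: "dropWhile (\<lambda>x. v < x) (rev xs) \<noteq> []" using False X unfolding X_def by fastforce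
      have "\<not> v < last X" using hd_dropWhile[OF ne] ne by (simp add: X_def last_rev)
      moreover have "last X \<in> set xs" using False X xsXT by simp
      ultimately show ?thesis using assms(1) by (metis linorder_neqE_nat)
    qed
    have hdY: "v < hd Y"
    proof -
      have "\<not> hd Y < v" using hd_dropWhile False unfolding Y_def by blast
      moreover have "hd Y \<in> set xs" using False X xsXT by simp
      ultimately show ?thesis using assms(1) by (metis linorder_neqE_nat)
    qed
    have Ine: "I \<noteq> []" unfolding I_def using hdY False by (cases Y) auto
    have lastY: "last Y < v" using lastX X False by simp
    have B2ne: "B\<^sub>2 \<noteq> []"
    proof
      assume "B\<^sub>2 = []"
      then have "last Y \<in> set I" using Y Ine by simp
      with I lastY show False by fastforce
    qed
    have hdB2: "hd B\<^sub>2 < v"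
    proof -
      have "\<not> v < hd B\<^sub>2" using hd_dropWhile B2ne unfolding B\<^sub>2_def by blast
      moreover have "hd B\<^sub>2 \<in> set xs" using B2ne X Y xsXT by simp
      ultimately show ?thesis using assms(1) by (metis linorder_neqE_nat)
    qed
    have lastB2: "last B\<^sub>2 < v" using lastY Y B2ne by simp
    have xs_eq: "xs = B\<^sub>1 @ I @ B\<^sub>2 @ T" using xsXT X Y by simp
    \<comment> \<open>Without their final 2, the patterns become 321 and 213, with \<open>v\<close>
      separating the lowest value from the other two.\<close>
    have no321: "\<not> (c < v \<and> v < b \<and> b < a)" and no213: "\<not> (b < v \<and> v < a \<and> a < c)"
      if "subseq [a, b, c] xs" for a b c
      using L that unfolding avoids_4312_3142_snoc by blast+
    have sortedI: "sorted_wrt (<) I"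
    proof (rule sorted_wrtI_subseq)
      fix a b assume ab: "subseq [a, b] I"
      then have mem: "a \<in> set I" "b \<in> set I" using subseq_set_mem(1)[OF ab] by blast+
      \<comment> \<open>A descent in \<open>I\<close> followed by the low entry
        \<open>hd B\<^sub>2\<close> would be a forbidden 321.\<close>
      have "subseq [a, b, hd B\<^sub>2] xs"
        using ab B2ne by (simp add: xs_eq subseq_append_cases)
      then have "\<not> b < a" using no321 hdB2 I mem by blast
      moreover have "a \<noteq> b" using distinct_subseq[OF ab] assms(2) xs_eq by simp
      ultimately show "a < b" by simp
    qed
    have TI: "x < y" if "x \<in> set T" "y \<in> set I" for x y
    proof -
      have "subseq [y, hd B\<^sub>2, x] xs"
        using that B2ne by (simp add: xs_eq subseq_append_cases subseq_singleton_left)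
      then have "\<not> y < x" using no213 hdB2 I that by blast
      moreover have "x \<noteq> y" using assms(2) that xs_eq by auto
      ultimately show ?thesis by simp
    qed
    have B2: "x < v" if "x \<in> set B\<^sub>2" for x
    proof (rule ccontr)
      assume "\<not> x < v"
      moreover have "x \<noteq> v" using that xs_eq assms(1) by auto
      ultimately have "v < x" by simp
      \<comment> \<open>A high \<open>x\<close> in \<open>B\<^sub>2\<close> would lie between two
        low entries of \<open>B\<^sub>2\<close>. Compared with \<open>y\<close> from
        \<open>I\<close>, it gives a 213 through \<open>hd B\<^sub>2\<close> if larger, and a 321
        through \<open>last B\<^sub>2\<close> if smaller.\<close>
      obtain y where y: "y \<in> set I" using Ine by (cases I) auto
      have "x \<noteq> hd B\<^sub>2" "x \<noteq> last B\<^sub>2" using \<open>v < x\<close> hdB2 lastB2 by auto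
      then have "subseq [hd B\<^sub>2, x] B\<^sub>2" "subseq [x, last B\<^sub>2] B\<^sub>2"
        using that by (auto simp: subseq_hd subseq_last)
      then have "subseq [y, hd B\<^sub>2, x] xs" "subseq [y, x, last B\<^sub>2] xs"
        using y by (simp_all add: xs_eq subseq_append_cases)
      then have "\<not> y < x" "\<not> x < y" using no213 no321 hdB2 lastB2 I[OF y] \<open>v < x\<close> by blast+
      moreover have "x \<noteq> y" using assms(2) that y xs_eq by auto
      ultimately show False by simp
    qed
    have "avoids_4312_3142 (B\<^sub>1 @ I @ B\<^sub>2) \<and> avoids_312 T"
    proof -
      have "x < y" if "x \<in> set (B\<^sub>1 @ B\<^sub>2)" "y \<in> set (I @ T)" for x y
        using that B1[of x] B2[of x] I[of y] T[of y] by auto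
      then show ?thesis
        using avoids_4312_3142_block_append[OF Ine sortedI, of B\<^sub>1 B\<^sub>2 T] TI xs xs_eq by blast
    qed
    then have ?R2
      using xs_eq Ine B2ne sortedI B1 B2 I T TI unfolding set_append Un_iff by blast
    then show ?thesis ..
  qed
next
  assume "?R1 \<or> ?R2"
  then show "avoids_4312_3142 (xs @ [v])"
  proof (elim disjE exE conjE)
    fix B T
    assume *: "xs = B @ T" "\<forall>x\<in>set B. x < v" "\<forall>x\<in>set T. v < x" "avoids_4312_3142 B" "avoids_4312_3142 T"
    then have "avoids_4312_3142 xs" using avoids_4312_3142_append[of B T] less_trans by blast
    moreover have "\<not> (c < v \<and> v < b \<and> b < a) \<and> \<not> (b < v \<and> v < a \<and> a < c)"
      if "subseq [a, b, c] xs" for a b c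
    proof -
      have "a < v \<or> v < b \<and> v < c"
        using that *(2,3) subseq_set_mem(1)[of a b B] subseq_set_mem(1)[of b c T]
          subseq_set_mem(2)[of a b c B] subseq_set_mem(2)[of a b c T]
        unfolding *(1) subseq_append_cases by blast
      then show ?thesis by auto
    qed
    ultimately show ?thesis unfolding avoids_4312_3142_snoc by blast
  next
    fix B\<^sub>1 I B\<^sub>2 T
    assume *: "xs = B\<^sub>1 @ I @ B\<^sub>2 @ T" "I \<noteq> []" "sorted_wrt (<) I"
      "\<forall>x\<in>set (B\<^sub>1 @ B\<^sub>2). x < v" "\<forall>x\<in>set (I @ T). v < x" "\<forall>x\<in>set T. \<forall>y\<in>set I. x < y"
      "avoids_4312_3142 (B\<^sub>1 @ I @ B\<^sub>2)" "avoids_312 T"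
    have BI: "x < y" if "x \<in> set (B\<^sub>1 @ B\<^sub>2)" "y \<in> set (I @ T)" for x y
      using that *(4,5) less_trans[of x v y] by blast
    have TI: "x < y" if "x \<in> set T" "y \<in> set I" for x y
      using that *(6) by blast
    have "avoids_4312_3142 (B\<^sub>1 @ I @ B\<^sub>2 @ T) \<longleftrightarrow> avoids_4312_3142 (B\<^sub>1 @ I @ B\<^sub>2) \<and> avoids_312 T"
      by (rule avoids_4312_3142_block_append[OF *(2,3)]) (fact BI TI)+
    then have "avoids_4312_3142 xs" using *(1,7,8) by simp
    moreover have "\<not> (c < v \<and> v < b \<and> b < a) \<and> \<not> (b < v \<and> v < a \<and> a < c)"
      if "subseq [a, b, c] xs" for a b c
    proof -
      have lt: "\<And>x. x \<in> set B\<^sub>1 \<Longrightarrow> x < v" "\<And>x. x \<in> set B\<^sub>2 \<Longrightarrow> x < v" "\<And>x. x \<in> set I \<Longrightarrow> v < x"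
        "\<And>x. x \<in> set T \<Longrightarrow> v < x" "\<And>x y. x \<in> set T \<Longrightarrow> y \<in> set I \<Longrightarrow> x < y"
        "\<And>x y. x \<in> set B\<^sub>2 \<Longrightarrow> y \<in> set I \<Longrightarrow> x < y"
        using *(4-6) BI by auto
      \<comment> \<open>Each of the four alternatives is incompatible with both forbidden
        shapes.\<close>
      have "a < v \<or> v < b \<and> v < c \<or> a < b \<and> v < b \<or> b < v \<and> c < a"
        using that unfolding *(1) subseq_append_cases set_append Un_iff
        by (elim disjE conjE) (blast dest: subseq_set_mem sorted_wrt_subseqD[OF *(3)] intro: lt)+
      then show ?thesis by auto
    qed
    ultimately show ?thesis unfolding avoids_4312_3142_snoc by blast
  qed
qed

section \<open>Shift invariance and counting over intervals\<close>

lemma subseq_map_iff: "subseq xs (map f p) \<longleftrightarrow> (\<exists>ys. subseq ys p \<and> xs = map f ys)"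
  by (auto simp: subseq_conv_nths nths_map)

lemma avoids_312_shift: "avoids_312 (map ((+) k) p) \<longleftrightarrow> avoids_312 p"
proof -
  have eq: "subseq [a, b, c] (map ((+) k) p) \<longleftrightarrow>
      (\<exists>a' b' c'. subseq [a', b', c'] p \<and> a = k + a' \<and> b = k + b' \<and> c = k + c')" for a b c
    by (auto simp: subseq_map_iff Cons_eq_map_conv)
  have "avoids_312 (map ((+) k) p) \<longleftrightarrow>
      (\<forall>a b c. subseq [a, b, c] p \<longrightarrow> \<not> (k + b < k + c \<and> k + c < k + a))"
    unfolding avoids_312_def eq by blast
  then show ?thesis unfolding avoids_312_def by simp
qed

lemma avoids_4312_3142_shift: "avoids_4312_3142 (map ((+) k) p) \<longleftrightarrow> avoids_4312_3142 p"
proof -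
  have eq: "subseq [a, b, c, d] (map ((+) k) p) \<longleftrightarrow>
      (\<exists>a' b' c' d'. subseq [a', b', c', d'] p \<and> a = k + a' \<and> b = k + b' \<and> c = k + c' \<and> d = k + d')" for a b c d
    by (auto simp: subseq_map_iff Cons_eq_map_conv)
  have "avoids_4312_3142 (map ((+) k) p) \<longleftrightarrow>
      (\<forall>a b c d. subseq [a, b, c, d] p \<longrightarrow> \<not> (k + c < k + d \<and> k + d < k + b \<and> k + b < k + a) \<and>
        \<not> (k + b < k + d \<and> k + d < k + a \<and> k + a < k + c))"
    unfolding avoids_4312_3142_def eq by blast
  then show ?thesis unfolding avoids_4312_3142_def by simp
qed

text \<open>Arbitrary value sets \<open>A\<close> avoid standardising the blocks of a permutation; all the value sets
  that occur are intervals, so invariance under shifts is enough for counting.\<close>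

definition perms_with :: "(nat list \<Rightarrow> bool) \<Rightarrow> nat set \<Rightarrow> nat list set" where
  "perms_with P A = {p. set p = A \<and> distinct p \<and> P p}"

definition perm_count :: "(nat list \<Rightarrow> bool) \<Rightarrow> nat \<Rightarrow> nat" where
  "perm_count P n = card (perms_with P {0..<n})"

lemma finite_perms_with: "finite (perms_with P A)"
proof -
  have "perms_with P A \<subseteq> permutations_of_set A"
    by (auto simp: perms_with_def permutations_of_set_def)
  then show ?thesis using finite_subset finite_permutations_of_set by blast
qed

lemma card_perms_with_shift:
  assumes shift: "\<And>k p. P (map ((+) k) p) \<longleftrightarrow> P p"
  shows "card (perms_with P {k..<k + n}) = perm_count P n"
proof -
  have "perms_with P {k..<k + n} = map ((+) k) ` perms_with P {0..<n}"
  proof (intro equalityI subsetI)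
    fix q assume q: "q \<in> perms_with P {k..<k + n}"
    define p where "p = map (\<lambda>x. x - k) q"
    have qp: "q = map ((+) k) p"
      using q by (auto simp: p_def perms_with_def intro!: map_idI[symmetric])
    have "((+) k) ` set p = ((+) k) ` {0..<n}"
      using q unfolding qp by (simp add: perms_with_def image_add_atLeastLessThan add.commute)
    then have "set p = {0..<n}" by (metis inj_image_eq_iff inj_on_add)
    then have "p \<in> perms_with P {0..<n}"
      using q unfolding qp by (simp add: perms_with_def shift distinct_map)
    with qp show "q \<in> map ((+) k) ` perms_with P {0..<n}" by blast
  next
    fix q assume "q \<in> map ((+) k) ` perms_with P {0..<n}"
    then show "q \<in> perms_with P {k..<k + n}"
      by (auto simp: perms_with_def shift distinct_map add.commute)
  qed
  moreover have "inj_on (map ((+) k)) (perms_with P {0..<n})"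
    by (simp add: inj_on_subset[OF _ subset_UNIV])
  ultimately show ?thesis by (simp add: perm_count_def card_image)
qed

section \<open>The case of low entries before high entries\<close>

text \<open>Generic in \<open>P\<close> because it serves twice: it exhausts the nonempty
  312-avoiders and is the first of two families for the main class. The last entry \<open>i\<close>
  forces the value sets of both blocks.\<close>

definition sum_snoc_perms :: "(nat list \<Rightarrow> bool) \<Rightarrow> nat \<Rightarrow> nat list set" where
  "sum_snoc_perms P n = (\<lambda>(i, B, T). B @ T @ [i]) `
     (SIGMA i:{..n}. perms_with P {0..<i} \<times> perms_with P {Suc i..<Suc n})"

lemma card_sum_snoc_perms:
  assumes shift: "\<And>k p. P (map ((+) k) p) \<longleftrightarrow> P p"
  shows "card (sum_snoc_perms P n) = (\<Sum>i\<le>n. perm_count P i * perm_count P (n - i))"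
proof -
  have "inj_on (\<lambda>(i, B, T). B @ T @ [i]) (SIGMA i:{..n}. perms_with P {0..<i} \<times> perms_with P {Suc i..<Suc n})"
  proof (intro inj_onI, clarsimp)
    fix i B T B' T'
    assume *: "B @ T = B' @ T'" "B \<in> perms_with P {0..<i}" "B' \<in> perms_with P {0..<i}"
    \<comment> \<open>The last entry recovers \<open>i\<close>, which is also the length of
      \<open>B\<close> and so locates the cut.\<close>
    have "length B = i" "length B' = i"
      using *(2,3) distinct_card[of B] distinct_card[of B'] by (auto simp: perms_with_def)
    with *(1) show "B = B' \<and> T = T'" by (simp add: append_eq_append_conv)
  qed
  moreover have "card (perms_with P {Suc i..<Suc n}) = perm_count P (n - i)" if "i \<le> n" for i
    using card_perms_with_shift[OF shift, of "Suc i" "n - i"] that by simp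
  ultimately show ?thesis
    unfolding sum_snoc_perms_def
    by (simp add: card_image card_SigmaI finite_perms_with card_cartesian_product perm_count_def)
qed

lemma snoc_perms_cases:
  assumes "p \<in> perms_with P {0..<Suc n}"
  obtains i xs where "p = xs @ [i]" "i \<le> n" "set xs = {0..<i} \<union> {Suc i..<Suc n}" "distinct xs" "i \<notin> set xs"
proof -
  have "p \<noteq> []" using assms by (auto simp: perms_with_def)
  then obtain xs i where p: "p = xs @ [i]" by (metis rev_exhaust)
  with assms have "insert i (set xs) = {0..<Suc n}" "i \<notin> set xs" "distinct xs"
    by (auto simp: perms_with_def)
  moreover from this have "i \<le> n" by auto
  moreover have "{0..<Suc n} - {i} = {0..<i} \<union> {Suc i..<Suc n}" using \<open>i \<le> n\<close> by auto
  then have "set xs = {0..<i} \<union> {Suc i..<Suc n}" using calculation by (metis Diff_insert_absorb)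
  ultimately show thesis using that p by blast
qed

lemma sum_snoc_split:
  assumes "xs = B @ T" "set xs = {0..<i} \<union> {Suc i..<Suc n}" "\<forall>x\<in>set B. x < i" "\<forall>x\<in>set T. i < x" "i \<le> n"
  shows "set B = {0..<i}" "set T = {Suc i..<Suc n}"
proof -
  have "set B = {x \<in> set xs. x < i}" "set T = {x \<in> set xs. i < x}"
    using assms(3,4) unfolding assms(1) set_append by (blast dest: less_asym)+
  moreover have "{x \<in> set xs. x < i} = {0..<i}" "{x \<in> set xs. i < x} = {Suc i..<Suc n}"
    if "i \<le> n" using that unfolding assms(2) by auto
  ultimately show "set B = {0..<i}" "set T = {Suc i..<Suc n}"
    using assms(5) by simp_all
qed

lemma perms_with_avoids_312_Suc:
  "perms_with avoids_312 {0..<Suc n} = sum_snoc_perms avoids_312 n"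
proof (intro equalityI subsetI)
  fix p assume p: "p \<in> perms_with avoids_312 {0..<Suc n}"
  then obtain i xs where i: "p = xs @ [i]" "i \<le> n" "set xs = {0..<i} \<union> {Suc i..<Suc n}" "distinct xs" "i \<notin> set xs"
    by (rule snoc_perms_cases) blast
  from p have "avoids_312 (xs @ [i])" by (simp add: i(1) perms_with_def)
  then obtain B T where BT: "xs = B @ T" "\<forall>x\<in>set B. x < i" "\<forall>x\<in>set T. i < x" "avoids_312 B" "avoids_312 T"
    unfolding avoids_312_snoc_iff[OF i(5)] by blast
  with i sum_snoc_split[OF BT(1) i(3) BT(2,3) i(2)] show "p \<in> sum_snoc_perms avoids_312 n"
    unfolding sum_snoc_perms_def
    by (intro image_eqI[of _ _ "(i, B, T)"]) (auto simp: perms_with_def)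
next
  fix p assume "p \<in> sum_snoc_perms avoids_312 n"
  then obtain i B T where p: "p = (B @ T) @ [i]" "i \<le> n" "B \<in> perms_with avoids_312 {0..<i}"
      "T \<in> perms_with avoids_312 {Suc i..<Suc n}"
    unfolding sum_snoc_perms_def by auto
  then have "i \<notin> set (B @ T)" by (auto simp: perms_with_def)
  then have "avoids_312 p" unfolding p(1) avoids_312_snoc_iff[OF \<open>i \<notin> set (B @ T)\<close>]
    using p(3,4) by (intro exI[of _ B] exI[of _ T]) (auto simp: perms_with_def)
  then show "p \<in> perms_with avoids_312 {0..<Suc n}"
    using p by (auto simp: perms_with_def)
qed

text \<open>The Catalan recurrence, the source of the equation for \<open>C\<close>.\<close>

lemma perm_count_avoids_312_Suc:
  "perm_count avoids_312 (Suc n) = (\<Sum>i\<le>n. perm_count avoids_312 i * perm_count avoids_312 (n - i))"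
  using card_sum_snoc_perms[of avoids_312 n] avoids_312_shift
  by (simp add: perm_count_def[of _ "Suc n"] perms_with_avoids_312_Suc)

section \<open>Avoiders whose maximum is not last\<close>

text \<open>The pairs \<open>(B\<^sub>1, B\<^sub>2)\<close> counted by \<open>G\<close>, with \<open>i\<close> as the maximum \<open>m\<close>.\<close>

definition max_split_perms :: "nat \<Rightarrow> (nat list \<times> nat list) set" where
  "max_split_perms i = {(B, B'). B @ [i] @ B' \<in> perms_with avoids_4312_3142 {0..<Suc i} \<and> B' \<noteq> []}"

lemma avoids_4312_3142_snoc_max:
  assumes "\<forall>x\<in>set B. x < i"
  shows "avoids_4312_3142 (B @ [i]) \<longleftrightarrow> avoids_4312_3142 B"
  using assms avoids_4312_3142_append[of B "[i]"]
  by (auto simp: avoids_4312_3142_def[of "[i]"] not_subseq_singleton)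

text \<open>The avoiders of length \<open>Suc i\<close> are split by whether their maximum
  \<open>i\<close> is last. Deleting a last maximum leaves an arbitrary avoider of length
  \<open>i\<close>.\<close>

lemma card_max_split_perms:
  "finite (max_split_perms i)"
  "card (max_split_perms i) + perm_count avoids_4312_3142 i = perm_count avoids_4312_3142 (Suc i)"
proof -
  let ?A = "(\<lambda>(B, B'). B @ [i] @ B') ` max_split_perms i"
  let ?B = "(\<lambda>B. B @ [i]) ` perms_with avoids_4312_3142 {0..<i}"
  have eq: "perms_with avoids_4312_3142 {0..<Suc i} = ?A \<union> ?B"
  proof (intro equalityI subsetI)
    fix p assume p: "p \<in> perms_with avoids_4312_3142 {0..<Suc i}"
    then have "i \<in> set p" by (simp add: perms_with_def)
    then obtain B B' where pB: "p = B @ [i] @ B'" by (metis append_Cons append_Nil split_list)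
    show "p \<in> ?A \<union> ?B"
    proof (cases "B' = []")
      case True
      have "insert i (set B) = insert i {0..<i}" "i \<notin> set B" "distinct B"
        using p pB True by (auto simp: perms_with_def atLeast0_lessThan_Suc)
      then have "set B = {0..<i}" using insert_ident[of i "set B" "{0..<i}"] by simp
      then have "B \<in> perms_with avoids_4312_3142 {0..<i}"
        using p pB True avoids_4312_3142_snoc_max[of B i] \<open>distinct B\<close> by (simp add: perms_with_def)
      then show ?thesis using pB True by auto
    next
      case False
      then have "(B, B') \<in> max_split_perms i" using p pB by (simp add: max_split_perms_def)
      then show ?thesis using pB by force
    qed
  next
    fix p assume "p \<in> ?A \<union> ?B"
    then show "p \<in> perms_with avoids_4312_3142 {0..<Suc i}"
      by (auto simp: max_split_perms_def perms_with_def avoids_4312_3142_snoc_max)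
  qed
  have inj: "inj_on (\<lambda>(B, B'). B @ [i] @ B') (max_split_perms i)"
  proof (intro inj_onI, clarify)
    fix B C B' C'
    assume *: "(B, B') \<in> max_split_perms i" "(C, C') \<in> max_split_perms i" "B @ [i] @ B' = C @ [i] @ C'"
    then have "i \<notin> set B" "i \<notin> set B'" by (auto simp: max_split_perms_def perms_with_def)
    then show "B = C \<and> B' = C'" using *(3) append_Cons_eq_iff[of i B B' C C'] by simp
  qed
  have "finite ?A" using finite_perms_with[of avoids_4312_3142 "{0..<Suc i}"] unfolding eq by simp
  then show "finite (max_split_perms i)" using inj finite_imageD by blast
  have "?A \<inter> ?B = {}"
  proof (intro equals0I)
    fix p assume "p \<in> ?A \<inter> ?B"
    then obtain B B' C where *: "B @ [i] @ B' = C @ [i]" "B' \<noteq> []" "C \<in> perms_with avoids_4312_3142 {0..<i}"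
      by (auto simp: max_split_perms_def)
    \<comment> \<open>Cancelling the common last entry leaves \<open>i\<close> inside
      \<open>C\<close>, whose entries are all below \<open>i\<close>.\<close>
    then have "C = B @ [i] @ butlast B'" by (metis butlast_append butlast_snoc append_is_Nil_conv)
    then show False using *(3) by (auto simp: perms_with_def)
  qed
  then have "perm_count avoids_4312_3142 (Suc i) = card ?A + card ?B"
    unfolding perm_count_def eq using \<open>finite ?A\<close> by (intro card_Un_disjoint) (auto simp: finite_perms_with)
  also have "card ?A = card (max_split_perms i)" by (rule card_image[OF inj])
  also have "card ?B = perm_count avoids_4312_3142 i"
    unfolding perm_count_def by (rule card_image) (simp add: inj_on_def)
  finally show "card (max_split_perms i) + perm_count avoids_4312_3142 i = perm_count avoids_4312_3142 (Suc i)"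
    by simp
qed

section \<open>The case with an increasing top block\<close>

text \<open>The criterion for inserting a block does not mention the block itself. Hence the run
  \<open>I\<close> can be exchanged for a single new maximum.\<close>

lemma avoids_4312_3142_block_cong:
  assumes "I \<noteq> []" "sorted_wrt (<) I" "J \<noteq> []" "sorted_wrt (<) J"
    and "\<And>x y. x \<in> set (B\<^sub>1 @ B\<^sub>2) \<Longrightarrow> y \<in> set I \<Longrightarrow> x < y"
    and "\<And>x y. x \<in> set (B\<^sub>1 @ B\<^sub>2) \<Longrightarrow> y \<in> set J \<Longrightarrow> x < y"
  shows "avoids_4312_3142 (B\<^sub>1 @ I @ B\<^sub>2) \<longleftrightarrow> avoids_4312_3142 (B\<^sub>1 @ J @ B\<^sub>2)"
  using avoids_4312_3142_insert_block[OF assms(1,2,5)] avoids_4312_3142_insert_block[OF assms(3,4,6)]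
  by simp

text \<open>Here \<open>i\<close> is the last entry, \<open>s - i\<close> the length of \<open>T\<close> and \<open>n - s\<close> the length of \<open>I\<close>.\<close>

definition block_snoc :: "nat \<Rightarrow> nat \<times> nat \<times> (nat list \<times> nat list) \<times> nat list \<Rightarrow> nat list" where
  "block_snoc n = (\<lambda>(s, i, (B\<^sub>1, B\<^sub>2), T). B\<^sub>1 @ [Suc s..<Suc n] @ B\<^sub>2 @ T @ [i])"

text \<open>The bound \<open>s < n\<close> keeps the increasing run nonempty, while
  \<open>i \<le> s\<close> allows \<open>T\<close> to be empty. The value \<open>i\<close> has two
  roles: last entry of the final list, and placeholder maximum between \<open>B\<^sub>1\<close> and
  \<open>B\<^sub>2\<close>.\<close>

definition block_data :: "nat \<Rightarrow> (nat \<times> nat \<times> (nat list \<times> nat list) \<times> nat list) set" where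
  "block_data n = (SIGMA s:{..<n}. SIGMA i:{..s}. max_split_perms i \<times> perms_with avoids_312 {Suc i..<Suc s})"

lemma max_split_permsD:
  assumes "(B\<^sub>1, B\<^sub>2) \<in> max_split_perms i"
  shows "set B\<^sub>1 \<union> set B\<^sub>2 = {0..<i}" "distinct (B\<^sub>1 @ B\<^sub>2)" "B\<^sub>2 \<noteq> []" "avoids_4312_3142 (B\<^sub>1 @ [i] @ B\<^sub>2)"
proof -
  have *: "insert i (set B\<^sub>1 \<union> set B\<^sub>2) = insert i {0..<i}" "i \<notin> set B\<^sub>1 \<union> set B\<^sub>2"
    using assms by (auto simp: max_split_perms_def perms_with_def atLeast0_lessThan_Suc)
  then show "set B\<^sub>1 \<union> set B\<^sub>2 = {0..<i}"
    using insert_ident[of i "set B\<^sub>1 \<union> set B\<^sub>2" "{0..<i}"] by simp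
  show "distinct (B\<^sub>1 @ B\<^sub>2)" "B\<^sub>2 \<noteq> []" "avoids_4312_3142 (B\<^sub>1 @ [i] @ B\<^sub>2)"
    using assms by (auto simp: max_split_perms_def perms_with_def)
qed

text \<open>All data can be read off the list. The last entry is \<open>i\<close>,
  \<open>B\<^sub>1\<close> is the longest prefix below \<open>i\<close>, and the run above
  \<open>i\<close> that follows stops at \<open>hd B\<^sub>2\<close>. The length of that run gives
  \<open>s\<close>, and \<open>T\<close> has \<open>s - i\<close> entries.\<close>

lemma inj_on_block_snoc: "inj_on (block_snoc n) (block_data n)"
proof (rule inj_onI)
  fix u v
  assume u: "u \<in> block_data n" and v: "v \<in> block_data n" and eq: "block_snoc n u = block_snoc n v"
  obtain s i B\<^sub>1 B\<^sub>2 T where u': "u = (s, i, (B\<^sub>1, B\<^sub>2), T)" by (metis surj_pair)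
  obtain t j C\<^sub>1 C\<^sub>2 U where v': "v = (t, j, (C\<^sub>1, C\<^sub>2), U)" by (metis surj_pair)
  have st: "s < n" "i \<le> s" "t < n" "j \<le> t" using u v by (auto simp: u' v' block_data_def)
  from eq have ij: "j = i" and *: "B\<^sub>1 @ [Suc s..<Suc n] @ B\<^sub>2 @ T = C\<^sub>1 @ [Suc t..<Suc n] @ C\<^sub>2 @ U"
    by (simp_all add: u' v' block_snoc_def del: upt_Suc flip: append_assoc)
  have "(B\<^sub>1, B\<^sub>2) \<in> max_split_perms i" "(C\<^sub>1, C\<^sub>2) \<in> max_split_perms i"
    using u v by (simp_all add: u' v' block_data_def ij)
  note B = max_split_permsD(1,3)[OF this(1)] and C = max_split_permsD(1,3)[OF this(2)]
  have hd: "hd B\<^sub>2 < i" "hd C\<^sub>2 < i"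
    using B C hd_in_set[of B\<^sub>2] hd_in_set[of C\<^sub>2] by auto
  have tw1: "takeWhile (\<lambda>x. x < i) (B @ [Suc r..<Suc n] @ Z) = B" if "set B \<subseteq> {0..<i}" "r < n" "i \<le> r" for B r Z
    using that by (subst takeWhile_append2) (auto simp: upt_conv_Cons simp del: upt_Suc)
  have sub: "set B\<^sub>1 \<subseteq> {0..<i}" "set C\<^sub>1 \<subseteq> {0..<i}" using B(1) C(1) by blast+
  have "B\<^sub>1 = C\<^sub>1"
    using tw1[OF sub(1) st(1,2), of "B\<^sub>2 @ T"] tw1[OF sub(2) st(3), of "C\<^sub>2 @ U"] st(4)
    unfolding ij * by simp
  with * have **: "[Suc s..<Suc n] @ B\<^sub>2 @ T = [Suc t..<Suc n] @ C\<^sub>2 @ U" by (simp del: upt_Suc)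
  have tw2: "takeWhile (\<lambda>x. i < x) ([Suc r..<Suc n] @ Z @ W) = [Suc r..<Suc n]"
    if "hd Z < i" "Z \<noteq> []" "i \<le> r" for r Z W
  proof (subst takeWhile_append2)
    show "[Suc r..<Suc n] @ takeWhile (\<lambda>x. i < x) (Z @ W) = [Suc r..<Suc n]"
      using that by (cases Z) (auto simp del: upt_Suc)
  qed (use that in auto)
  have upt: "[Suc s..<Suc n] = [Suc t..<Suc n]"
    using arg_cong[OF **, of "takeWhile (\<lambda>x. i < x)"] tw2[OF hd(1) B(2), of s T] tw2[OF hd(2) C(2), of t U] st ij
    by simp
  have "s = t" using arg_cong[OF upt, of length] st unfolding length_upt by linarith
  have "B\<^sub>2 @ T = C\<^sub>2 @ U" using ** upt by (simp del: upt_Suc)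
  moreover have "length T = length U"
  proof -
    have "T \<in> perms_with avoids_312 {Suc i..<Suc s}" "U \<in> perms_with avoids_312 {Suc i..<Suc s}"
      using u v by (auto simp: u' v' block_data_def ij \<open>s = t\<close>)
    then show ?thesis using distinct_card[of T] distinct_card[of U] by (simp add: perms_with_def)
  qed
  ultimately show "u = v" using \<open>B\<^sub>1 = C\<^sub>1\<close> \<open>s = t\<close> ij by (simp add: u' v')
qed

lemma card_block_snoc:
  "card (block_snoc n ` block_data n) =
    (\<Sum>s<n. \<Sum>i\<le>s. card (max_split_perms i) * perm_count avoids_312 (s - i))"
proof -
  have "card (perms_with avoids_312 {Suc i..<Suc s}) = perm_count avoids_312 (s - i)" if "i \<le> s" for i s
    using card_perms_with_shift[OF avoids_312_shift, of "Suc i" "s - i"] that by simp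
  then show ?thesis
    unfolding card_image[OF inj_on_block_snoc] unfolding block_data_def
    by (simp add: finite_perms_with card_max_split_perms(1) card_cartesian_product)
qed

text \<open>The last entry fixes \<open>i\<close> in both families. After the longest prefix below
  \<open>i\<close>, the first family has only larger entries before \<open>i\<close>, but the second
  still contains the nonempty \<open>B\<^sub>2\<close>.\<close>

lemma sum_snoc_block_snoc_disjoint:
  "sum_snoc_perms avoids_4312_3142 n \<inter> block_snoc n ` block_data n = {}"
proof (rule equals0I)
  fix p assume p_in: "p \<in> sum_snoc_perms avoids_4312_3142 n \<inter> block_snoc n ` block_data n"
  then obtain j B U where p: "p = B @ U @ [j]" and "B \<in> perms_with avoids_4312_3142 {0..<j}"
      "U \<in> perms_with avoids_4312_3142 {Suc j..<Suc n}"
    by (auto simp: sum_snoc_perms_def)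
  then have BU: "set B = {0..<j}" "set U = {Suc j..<Suc n}" by (simp_all add: perms_with_def)
  from p_in obtain s i B\<^sub>1 B\<^sub>2 T where p': "p = B\<^sub>1 @ [Suc s..<Suc n] @ B\<^sub>2 @ T @ [i]"
    and s: "s < n" "i \<le> s" "(B\<^sub>1, B\<^sub>2) \<in> max_split_perms i"
    by (auto simp: block_snoc_def block_data_def simp del: upt_Suc)
  from p p' have ij: "j = i" and eq: "B @ U = B\<^sub>1 @ [Suc s..<Suc n] @ B\<^sub>2 @ T"
    by (simp_all del: upt_Suc flip: append_assoc)
  note B12 = max_split_permsD(1,3)[OF s(3)]
  have "\<not> x < i" if "x \<in> set U" for x using that BU(2) ij by simp
  then have "dropWhile (\<lambda>x. x < i) U = U" by (cases U) simp_all
  then have "U = dropWhile (\<lambda>x. x < i) (B @ U)"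
    using BU(1) ij by (subst dropWhile_append2) simp_all
  also have "\<dots> = [Suc s..<Suc n] @ B\<^sub>2 @ T"
    unfolding eq using B12(1) s by (subst dropWhile_append2) (auto simp: upt_conv_Cons simp del: upt_Suc)
  finally have "set B\<^sub>2 \<subseteq> set U" by auto
  moreover have "hd B\<^sub>2 \<in> set B\<^sub>2" "hd B\<^sub>2 \<in> {0..<i}" using B12 hd_in_set[of B\<^sub>2] by blast+
  ultimately show False using BU(2) ij by auto
qed

lemma perms_with_avoids_4312_3142_Suc:
  "perms_with avoids_4312_3142 {0..<Suc n} =
    sum_snoc_perms avoids_4312_3142 n \<union> block_snoc n ` block_data n"
proof (intro equalityI subsetI)
  fix p assume p: "p \<in> perms_with avoids_4312_3142 {0..<Suc n}"
  then obtain i xs where i: "p = xs @ [i]" "i \<le> n" "set xs = {0..<i} \<union> {Suc i..<Suc n}" "distinct xs" "i \<notin> set xs"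
    by (rule snoc_perms_cases) blast
  from p have "avoids_4312_3142 (xs @ [i])" by (simp add: i(1) perms_with_def)
  then show "p \<in> sum_snoc_perms avoids_4312_3142 n \<union> block_snoc n ` block_data n"
    unfolding avoids_4312_3142_snoc_iff[OF i(5,4)]
  proof (elim disjE exE conjE)
    fix B T
    assume sum: "xs = B @ T" "\<forall>x\<in>set B. x < i" "\<forall>x\<in>set T. i < x"
      "avoids_4312_3142 B" "avoids_4312_3142 T"
    with i sum_snoc_split[OF sum(1) i(3) sum(2,3) i(2)] have "p \<in> sum_snoc_perms avoids_4312_3142 n"
      unfolding sum_snoc_perms_def
      by (intro image_eqI[of _ _ "(i, B, T)"]) (auto simp: perms_with_def)
    then show ?thesis ..
  next
    fix B\<^sub>1 I B\<^sub>2 T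
    assume block: "xs = B\<^sub>1 @ I @ B\<^sub>2 @ T" "I \<noteq> []" "B\<^sub>2 \<noteq> []" "sorted_wrt (<) I"
      "\<forall>x\<in>set (B\<^sub>1 @ B\<^sub>2). x < i" "\<forall>x\<in>set (I @ T). i < x" "\<forall>x\<in>set T. \<forall>y\<in>set I. x < y"
      "avoids_4312_3142 (B\<^sub>1 @ I @ B\<^sub>2)" "avoids_312 T"
    have sets: "set (B\<^sub>1 @ B\<^sub>2) = {0..<i}" "set (I @ T) = {Suc i..<Suc n}"
    proof -
      have "set (B\<^sub>1 @ B\<^sub>2 @ I @ T) = {0..<i} \<union> {Suc i..<Suc n}"
        unfolding i(3)[symmetric] block(1) by auto
      then show "set (B\<^sub>1 @ B\<^sub>2) = {0..<i}" "set (I @ T) = {Suc i..<Suc n}"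
        using sum_snoc_split[of _ "B\<^sub>1 @ B\<^sub>2" "I @ T", OF _ _ block(5,6) i(2)] by simp_all
    qed
    \<comment> \<open>Since \<open>I\<close> is increasing and lies above \<open>T\<close>, its head
      is the threshold that cuts the values above \<open>i\<close> into those of \<open>T\<close>
      and those of \<open>I\<close>.\<close>
    define m where "m = hd I"
    have m: "m \<in> set I" "\<forall>x\<in>set I. m \<le> x"
      using block(2,4) unfolding m_def by (cases I; auto)+
    then have "Suc i \<le> m" "m < Suc n" using sets(2) by auto
    have T: "set T = {Suc i..<m}" and I: "set I = {m..<Suc n}"
    proof -
      have lt: "x < m" if "x \<in> set T" for x using that m(1) block(7) by blast
      have ge: "\<not> x < m" if "x \<in> set I" for x using that m(2) by (simp add: not_less)
      have U: "set I \<union> set T = {Suc i..<Suc n}" using sets(2) by simp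
      have "set T = {x \<in> set I \<union> set T. x < m}" using lt ge by blast
      also have "\<dots> = {Suc i..<m}" unfolding U using \<open>m < Suc n\<close> by auto
      finally show "set T = {Suc i..<m}" .
      have "set I = {x \<in> set I \<union> set T. \<not> x < m}" using lt ge by blast
      also have "\<dots> = {m..<Suc n}" unfolding U using \<open>Suc i \<le> m\<close> by auto
      finally show "set I = {m..<Suc n}" .
    qed
    obtain s where s: "m = Suc s" "i \<le> s" "s < n"
      using \<open>Suc i \<le> m\<close> \<open>m < Suc n\<close> by (cases m) auto
    \<comment> \<open>A strictly increasing list is determined by its set.\<close>
    have "I = [Suc s..<Suc n]"
      using block(4) I unfolding s(1) by (intro strict_sorted_equal) (simp_all del: upt_Suc)
    moreover have "(B\<^sub>1, B\<^sub>2) \<in> max_split_perms i"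
    proof -
      have lt: "x < y" if "x \<in> set (B\<^sub>1 @ B\<^sub>2)" "y \<in> set [i]" for x y
        using that block(5) by simp
      have ltI: "x < y" if "x \<in> set (B\<^sub>1 @ B\<^sub>2)" "y \<in> set I" for x y
        using that block(5,6) less_trans[of x i y] by simp
      have "avoids_4312_3142 (B\<^sub>1 @ [i] @ B\<^sub>2) \<longleftrightarrow> avoids_4312_3142 (B\<^sub>1 @ I @ B\<^sub>2)"
        by (rule avoids_4312_3142_block_cong[OF _ _ block(2,4) lt ltI]) simp_all
      moreover have "i \<notin> set (B\<^sub>1 @ B\<^sub>2)" using block(5) by blast
      moreover have "set (B\<^sub>1 @ [i] @ B\<^sub>2) = insert i (set (B\<^sub>1 @ B\<^sub>2))" by simp
      then have "set (B\<^sub>1 @ [i] @ B\<^sub>2) = {0..<Suc i}" unfolding sets(1) by (simp add: atLeast0_lessThan_Suc)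
      ultimately show ?thesis
        using block(1,3,8) i(4) by (auto simp: max_split_perms_def perms_with_def)
    qed
    moreover have "T \<in> perms_with avoids_312 {Suc i..<Suc s}"
      using T block(1,9) i(4) s(1) by (simp add: perms_with_def)
    ultimately have "p = block_snoc n (s, i, (B\<^sub>1, B\<^sub>2), T)" "(s, i, (B\<^sub>1, B\<^sub>2), T) \<in> block_data n"
      using i(1) block(1) s by (simp_all add: block_snoc_def block_data_def del: upt_Suc)
    then show ?thesis by blast
  qed
next
  fix p assume "p \<in> sum_snoc_perms avoids_4312_3142 n \<union> block_snoc n ` block_data n"
  then show "p \<in> perms_with avoids_4312_3142 {0..<Suc n}"
  proof
    assume "p \<in> sum_snoc_perms avoids_4312_3142 n"
    then obtain i B T where p: "p = (B @ T) @ [i]" "i \<le> n" "B \<in> perms_with avoids_4312_3142 {0..<i}"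
        "T \<in> perms_with avoids_4312_3142 {Suc i..<Suc n}"
      unfolding sum_snoc_perms_def by auto
    then have ni: "i \<notin> set (B @ T)" and d: "distinct (B @ T)" by (auto simp: perms_with_def)
    have "avoids_4312_3142 p" unfolding p(1) avoids_4312_3142_snoc_iff[OF ni d]
      using p(3,4) by (intro disjI1 exI[of _ B] exI[of _ T]) (auto simp: perms_with_def)
    then show ?thesis
      using p by (auto simp: perms_with_def)
  next
    assume "p \<in> block_snoc n ` block_data n"
    then obtain s i B\<^sub>1 B\<^sub>2 T where p: "p = (B\<^sub>1 @ [Suc s..<Suc n] @ B\<^sub>2 @ T) @ [i]" and s: "s < n" "i \<le> s"
      and B: "(B\<^sub>1, B\<^sub>2) \<in> max_split_perms i" and T: "T \<in> perms_with avoids_312 {Suc i..<Suc s}"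
      by (auto simp: block_snoc_def block_data_def simp del: upt_Suc)
    define I where "I = [Suc s..<Suc n]"
    have I: "I \<noteq> []" "sorted_wrt (<) I" "set I = {Suc s..<Suc n}" "distinct I" using s by (auto simp: I_def simp del: upt_Suc)
    note B = max_split_permsD[OF B]
    have T: "set T = {Suc i..<Suc s}" "distinct T" "avoids_312 T" using T by (auto simp: perms_with_def)
    have lt: "\<forall>x\<in>set (B\<^sub>1 @ B\<^sub>2). x < i" "\<forall>x\<in>set (I @ T). i < x" "\<forall>x\<in>set T. \<forall>y\<in>set I. x < y"
      unfolding set_append B(1) T(1) I(3) using s by auto
    have d: "distinct (B\<^sub>1 @ I @ B\<^sub>2 @ T)" and ni: "i \<notin> set (B\<^sub>1 @ I @ B\<^sub>2 @ T)"
      using B(2) I(4) T(2) lt by (auto dest: less_asym)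
    have lti: "x < y" if "x \<in> set (B\<^sub>1 @ B\<^sub>2)" "y \<in> set [i]" for x y
      using that lt(1) by simp
    have ltI: "x < y" if "x \<in> set (B\<^sub>1 @ B\<^sub>2)" "y \<in> set I" for x y
      using that lt(1,2) less_trans[of x i y] by simp
    have "avoids_4312_3142 (B\<^sub>1 @ I @ B\<^sub>2) \<longleftrightarrow> avoids_4312_3142 (B\<^sub>1 @ [i] @ B\<^sub>2)"
      by (rule avoids_4312_3142_block_cong[OF I(1,2) _ _ ltI lti]) simp_all
    then have "avoids_4312_3142 ((B\<^sub>1 @ I @ B\<^sub>2 @ T) @ [i])"
      unfolding avoids_4312_3142_snoc_iff[OF ni d] using I(1,2) B(3,4) T(3) lt by blast
    moreover have "set ((B\<^sub>1 @ I @ B\<^sub>2 @ T) @ [i]) = {0..<Suc n}"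
    proof -
      have "set ((B\<^sub>1 @ I @ B\<^sub>2 @ T) @ [i]) = (set B\<^sub>1 \<union> set B\<^sub>2) \<union> set I \<union> set T \<union> {i}" by auto
      also have "\<dots> = {0..<Suc n}" unfolding B(1) I(3) T(1) using s by auto
      finally show ?thesis .
    qed
    ultimately show ?thesis
      using d ni unfolding p I_def[symmetric] by (simp add: perms_with_def)
  qed
qed

lemma finite_block_data: "finite (block_data n)"
  by (simp add: block_data_def finite_perms_with card_max_split_perms(1))

lemma perm_count_avoids_4312_3142_Suc:
  "perm_count avoids_4312_3142 (Suc n) =
    (\<Sum>i\<le>n. perm_count avoids_4312_3142 i * perm_count avoids_4312_3142 (n - i)) +
    (\<Sum>s<n. \<Sum>i\<le>s. card (max_split_perms i) * perm_count avoids_312 (s - i))"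
proof -
  have "finite (sum_snoc_perms avoids_4312_3142 n)"
    using finite_perms_with[of avoids_4312_3142 "{0..<Suc n}"] unfolding perms_with_avoids_4312_3142_Suc by simp
  then show ?thesis
    unfolding perm_count_def[of _ "Suc n"] perms_with_avoids_4312_3142_Suc
      card_block_snoc[symmetric] card_sum_snoc_perms[OF avoids_4312_3142_shift, symmetric]
    by (intro card_Un_disjoint finite_imageI finite_block_data sum_snoc_block_snoc_disjoint)
qed

section \<open>Generating functions and elimination\<close>

lemma perm_count_0: "P [] \<Longrightarrow> perm_count P 0 = 1"
proof -
  assume "P []"
  then have "perms_with P {0..<0} = {[]}" by (auto simp: perms_with_def)
  then show ?thesis by (simp add: perm_count_def)
qed

text \<open>The values \<open>{1..n}\<close> are those of \<open>{0..<n}\<close> shifted by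
  one.\<close>

lemma av_count_eq: "av_count n = perm_count avoids_4312_3142 n"
proof -
  have "{p \<in> permutations_of_set {1..n}. avoids p [4, 3, 1, 2] \<and> avoids p [3, 1, 4, 2]} =
      perms_with avoids_4312_3142 {1..<1 + n}"
    unfolding perms_with_def permutations_of_set_def avoids_4312_3142_iff
    by (simp add: atLeastLessThanSuc_atLeastAtMost)
  then show ?thesis
    unfolding av_count_def using card_perms_with_shift[OF avoids_4312_3142_shift, of 1 n] by simp
qed

theorem theorem4p2:
  fixes f :: "int fps" and x :: "int fps"
  defines "f \<equiv> av_gf" and "x \<equiv> fps_X"
  shows "(x^3 - 2*x^2 + x) * f^4 + (4*x^3 - 9*x^2 + 6*x - 1) * f^3
       + (6*x^3 - 12*x^2 + 7*x - 1) * f^2 + (4*x^3 - 5*x^2 + x) * f + x^3 = 0"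
proof -
  define a where "a n = int (perm_count avoids_4312_3142 n)" for n
  define c where "c n = int (perm_count avoids_312 n)" for n
  define g where "g n = int (card (max_split_perms n))" for n
  define F where "F = Abs_fps a"
  define C where "C = Abs_fps c"
  define G where "G = Abs_fps g"
  \<comment> \<open>The second sum of the recurrence. Taking partial sums multiplies by
    \<open>x / (1 - x)\<close>, stated below without division.\<close>
  define D where "D = Abs_fps (\<lambda>n. \<Sum>s<n. fps_nth (G * C) s)"
  have a0: "a 0 = 1" and c0: "c 0 = 1"
    by (simp_all add: a_def c_def perm_count_0 avoids_4312_3142_def avoids_312_def)
  have g: "g n = a (Suc n) - a n" for n
    using card_max_split_perms(2)[of n] by (simp add: g_def a_def)
  \<comment> \<open>\<open>F\<close> counts the empty permutation, which \<open>av_gf\<close>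
    drops.\<close>
  have f: "f = F - 1"
    by (rule fps_ext) (simp add: f_def av_gf_def F_def a_def av_count_eq perm_count_0 avoids_4312_3142_def)
  have C: "C = 1 + x * (C * C)"
  proof (rule fps_ext)
    fix n
    have "c (Suc m) = fps_nth (C * C) m" for m
      by (simp add: C_def fps_mult_nth c_def perm_count_avoids_312_Suc atLeast0AtMost)
    then show "fps_nth C n = fps_nth (1 + x * (C * C)) n"
      by (cases n) (simp_all add: C_def c0 x_def)
  qed
  have F: "F = 1 + x * (F * F + D)"
  proof (rule fps_ext)
    fix n
    have "a (Suc m) = fps_nth (F * F + D) m" for m
      by (simp add: F_def D_def G_def C_def fps_mult_nth a_def g_def c_def
          perm_count_avoids_4312_3142_Suc atLeast0AtMost)
    then show "fps_nth F n = fps_nth (1 + x * (F * F + D)) n"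
      by (cases n) (simp_all add: F_def a0 x_def)
  qed
  have D: "(1 - x) * D = x * (G * C)"
  proof (rule fps_ext)
    fix n show "fps_nth ((1 - x) * D) n = fps_nth (x * (G * C)) n"
      by (cases n) (simp_all add: D_def x_def left_diff_distrib)
  qed
  have G: "x * G = F - 1 - x * F"
  proof (rule fps_ext)
    fix n show "fps_nth (x * G) n = fps_nth (F - 1 - x * F) n"
      by (cases n) (simp_all add: G_def F_def x_def g a0)
  qed
  \<comment> \<open>Chosen so that \<open>P = x * G\<close> and \<open>Q = x * C * P\<close>, while
    both are polynomials in \<open>x\<close> and \<open>f\<close>. Substituting
    \<open>C = Q / (x * P)\<close> into the Catalan equation and clearing denominators gives
    \<open>x * P^2 - P * Q + Q^2 = 0\<close>.\<close>
  define P where "P = f - x * F"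
  define Q where "Q = (1 - x) * (f - x * F^2)"
  have P: "P = x * G" by (simp add: P_def f G)
  have "f - x * F^2 = x * D" using F by (simp add: f power2_eq_square algebra_simps)
  then have Q: "Q = x * C * P" unfolding Q_def P using D by (simp add: mult.left_commute mult.assoc)
  have "x * P^2 - P * Q + Q^2 = x * P^2 * (1 + x * (C * C) - C)"
    unfolding Q by (simp add: power2_eq_square algebra_simps)
  also have "\<dots> = 0" using C by simp
  finally have "x * P^2 - P * Q + Q^2 = 0" .
  moreover have "x * P^2 - P * Q + Q^2 = x * ((x^3 - 2*x^2 + x) * f^4 + (4*x^3 - 9*x^2 + 6*x - 1) * f^3
       + (6*x^3 - 12*x^2 + 7*x - 1) * f^2 + (4*x^3 - 5*x^2 + x) * f + x^3)"
  proof -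
    have "F = f + 1" by (simp add: f)
    then show ?thesis unfolding P_def Q_def by algebra
  qed
  \<comment> \<open>The spare factor \<open>x\<close> cancels because power series over the integers
    have no zero divisors.\<close>
  moreover have "x \<noteq> 0" by (simp add: x_def)
  ultimately show ?thesis by (metis mult_eq_0_iff)
qed

end
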